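(* Let $H\in M_d(\mathbb{C})$ be Hermitian with non-degenerate spectrum and orthonormal eigenbasis $\{|j\rangle\}_{j=1}^d$, and let $\mathbb{G}_0[X]=\sum_{j=1}^d\langle j|X|j\rangle\,|j\rangle\langle j|$. Let $\mathbb{D}[\rho]=\sum_\alpha\big(h_\alpha\rho h_\alpha^\dagger-\tfrac12\{h_\alpha^\dagger h_\alpha,\rho\}\big)$ with $h_\alpha\in M_d(\mathbb{C})$, and set $\widehat{\mathbb{D}}=\mathbb{G}_0\circ\mathbb{D}\circ\mathbb{G}_0$. Then $\widehat{\mathbb{D}}$ generates a semigroup $e^{t\widehat{\mathbb{D}}}$, $t\ge0$, of positive, trace-preserving maps on the set of density matrices commuting with $H$ (i.e. density matrices of the form $\sum_j\rho_{jj}|j\rangle\langle j|$): for every such density matrix $\rho$ and every $t\ge0$, $e^{t\widehat{\mathbb{D}}}[\rho]$ is again a density matrix commuting with $H$.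
   Context: $\mathbb{G}_0$ is the time average of the unitary evolution $\rho\mapsto e^{-itH}\rho e^{itH}$, i.e. the projection onto the diagonal part in the eigenbasis of $H$; the density matrices commuting with $H$ are exactly the states invariant under that unitary evolution. *)

theory Defs
  imports "HOL-Analysis.Analysis"
begin

text \<open>Matrices in M_d(C) are rendered as complex^'n^'n, with d = CARD('n).\<close>

definition cadj :: "complex^'n^'n \<Rightarrow> complex^'n^'n" where
  "cadj M = (\<chi> i j. cnj (M $ j $ i))"

definition hermitian :: "complex^'n^'n \<Rightarrow> bool" where
  "hermitian M \<longleftrightarrow> cadj M = M"

text \<open>inner product <v|w>, linear in the second argument\<close>
definition braket :: "complex^'n \<Rightarrow> complex^'n \<Rightarrow> complex" where
  "braket v w = (\<Sum>i\<in>UNIV. cnj (v $ i) * w $ i)"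

text \<open>outer product |v><w|\<close>
definition ketbra :: "complex^'n \<Rightarrow> complex^'n \<Rightarrow> complex^'n^'n" where
  "ketbra v w = (\<chi> i k. v $ i * cnj (w $ k))"

definition csmat :: "complex \<Rightarrow> complex^'n^'n \<Rightarrow> complex^'n^'n" where
  "csmat c M = (\<chi> i k. c * M $ i $ k)"

definition orthonormal_basis :: "('n \<Rightarrow> complex^'n) \<Rightarrow> bool" where
  "orthonormal_basis e \<longleftrightarrow> (\<forall>j k. braket (e j) (e k) = (if j = k then 1 else 0))"

text \<open>positive semidefinite: <v|M|v> is real and nonnegative for all v\<close>
definition psd :: "complex^'n^'n \<Rightarrow> bool" where
  "psd M \<longleftrightarrow> hermitian M \<and> (\<forall>v. Im (braket v (M *v v)) = 0 \<and> Re (braket v (M *v v)) \<ge> 0)"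

definition density_matrix :: "complex^'n^'n \<Rightarrow> bool" where
  "density_matrix \<rho> \<longleftrightarrow> psd \<rho> \<and> trace \<rho> = 1"

text \<open>G_0[X] = sum_j <j|X|j> |j><j|\<close>
definition G0 :: "('n \<Rightarrow> complex^'n) \<Rightarrow> complex^'n^'n \<Rightarrow> complex^'n^'n" where
  "G0 e X = (\<Sum>j\<in>UNIV. csmat (braket (e j) (X *v e j)) (ketbra (e j) (e j)))"

text \<open>Lindblad dissipator with a finite family of jump operators h indexed by A\<close>
definition dissipator :: "'a set \<Rightarrow> ('a \<Rightarrow> complex^'n^'n) \<Rightarrow> complex^'n^'n \<Rightarrow> complex^'n^'n" where
  "dissipator A h \<rho> = (\<Sum>\<alpha>\<in>A. h \<alpha> ** \<rho> ** cadj (h \<alpha>)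
      - (1/2::real) *\<^sub>R (cadj (h \<alpha>) ** h \<alpha> ** \<rho> + \<rho> ** (cadj (h \<alpha>) ** h \<alpha>)))"

text \<open>exponential of a linear superoperator L: e^{tL}[X] = sum_n t^n/n! L^n[X]\<close>
definition super_exp :: "real \<Rightarrow> (complex^'n^'n \<Rightarrow> complex^'n^'n) \<Rightarrow> complex^'n^'n \<Rightarrow> complex^'n^'n" where
  "super_exp t L X = (\<Sum>n. (t ^ n / fact n) *\<^sub>R (L ^^ n) X)"

end

theory Submission
  imports Defs
begin

text \<open>In the eigenbasis of \<open>H\<close>, a state commuting with the non-degenerate \<open>H\<close> is diagonal, and
  \<open>G0\<close> keeps the diagonal of a matrix and discards the rest. On diagonal matrices \<open>diag p\<close> the
  generator \<open>L = G0 \<circ> D \<circ> G0\<close> therefore acts as \<open>diag (Q p)\<close>, where \<open>Q\<close> is the rate matrix of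
  the Pauli master equation (rate \<open>\<Sum>\<alpha> |<j|h \<alpha>|k>|^2\<close> for the jump \<open>k \<rightarrow> j\<close>), so
  \<open>exp (t L) (diag p) = diag (exp (t Q) p)\<close>. Since the columns of \<open>Q\<close> sum to zero, \<open>exp (t Q)\<close>
  preserves total mass; writing \<open>Q = M - c I\<close> with \<open>M\<close> entrywise nonnegative gives
  \<open>exp (t Q) = exp (-c t) exp (t M)\<close>, which preserves nonnegativity.\<close>

definition op_exp :: "real \<Rightarrow> ('a::real_normed_vector \<Rightarrow> 'a) \<Rightarrow> 'a \<Rightarrow> 'a" where
  "op_exp t f x = (\<Sum>n. (t ^ n / fact n) *\<^sub>R (f ^^ n) x)"

lemma bounded_linear_funpow_bound:
  fixes f :: "'a::real_normed_vector \<Rightarrow> 'a"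
  assumes "bounded_linear f"
  obtains K where "K > 0" "\<And>n x. norm ((f ^^ n) x) \<le> K ^ n * norm x"
proof -
  obtain K where K: "K > 0" "\<And>x. norm (f x) \<le> norm x * K"
    using bounded_linear.pos_bounded[OF assms] by blast
  have "norm ((f ^^ n) x) \<le> K ^ n * norm x" for n x
  proof (induction n)
    case 0
    then show ?case by simp
  next
    case (Suc n)
    have "norm ((f ^^ Suc n) x) \<le> norm ((f ^^ n) x) * K"
      using K(2) by simp
    also have "\<dots> \<le> K ^ n * norm x * K"
      using Suc K(1) by (simp add: mult_right_mono)
    finally show ?case
      by (simp add: algebra_simps)
  qed
  with K(1) that show ?thesis by blast
qed

lemma summable_norm_op_exp_terms:
  fixes f :: "'a::real_normed_vector \<Rightarrow> 'a"
  assumes "bounded_linear f"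
  shows "summable (\<lambda>n. norm ((t ^ n / fact n) *\<^sub>R (f ^^ n) x))"
proof -
  obtain K where K: "K > 0" "\<And>n x. norm ((f ^^ n) x) \<le> K ^ n * norm x"
    using bounded_linear_funpow_bound[OF assms] by blast
  have bound: "norm ((t ^ n / fact n) *\<^sub>R (f ^^ n) x) \<le> norm x * (inverse (fact n) * (\<bar>t\<bar> * K) ^ n)" for n
  proof -
    have "norm ((t ^ n / fact n) *\<^sub>R (f ^^ n) x) = \<bar>t\<bar> ^ n / fact n * norm ((f ^^ n) x)"
      by (simp add: power_abs)
    also have "\<dots> \<le> \<bar>t\<bar> ^ n / fact n * (K ^ n * norm x)"
      by (intro mult_left_mono K(2)) auto
    finally show ?thesis
      by (simp add: power_mult_distrib field_simps)
  qed
  have "summable (\<lambda>n. norm x * (inverse (fact n) * (\<bar>t\<bar> * K) ^ n))"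
    by (intro summable_mult summable_exp)
  then show ?thesis
    by (rule summable_comparison_test') (simp only: real_norm_def abs_norm_cancel bound)
qed

lemma summable_op_exp_terms:
  fixes f :: "'a::banach \<Rightarrow> 'a"
  assumes "bounded_linear f"
  shows "summable (\<lambda>n. (t ^ n / fact n) *\<^sub>R (f ^^ n) x)"
  by (rule summable_norm_cancel[OF summable_norm_op_exp_terms[OF assms]])

lemma op_exp_intertwine:
  fixes f :: "'a::banach \<Rightarrow> 'a" and g :: "'b::real_normed_vector \<Rightarrow> 'b"
  assumes "bounded_linear f" and T: "bounded_linear T" and comm: "\<And>y. T (f y) = g (T y)"
  shows "T (op_exp t f x) = op_exp t g (T x)"
proof -
  have "T ((f ^^ n) x) = (g ^^ n) (T x)" for n
    by (induction n) (simp_all add: comm)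
  then show ?thesis
    unfolding op_exp_def
    using bounded_linear.suminf[OF T summable_op_exp_terms[OF assms(1)]]
    by (simp add: linear_scale[OF bounded_linear.linear[OF T]])
qed

lemma op_exp_of_vanishing:
  assumes "\<And>y. f y = 0"
  shows "op_exp t f x = x"
proof -
  have "(\<lambda>n. (t ^ n / fact n) *\<^sub>R (f ^^ n) x) = (\<lambda>n. if n = 0 then x else 0)"
    by (auto simp: fun_eq_iff gr0_conv_Suc assms)
  then show ?thesis
    unfolding op_exp_def using sums_single[of 0 "\<lambda>_. x"] by (simp add: sums_iff)
qed

lemma op_exp_conserved:
  fixes f :: "'a::banach \<Rightarrow> 'a"
  assumes "bounded_linear f" and "bounded_linear \<phi>" and "\<And>y. \<phi> (f y) = 0"
  shows "\<phi> (op_exp t f x) = \<phi> x"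
  using op_exp_intertwine[OF assms(1,2), of "\<lambda>_. 0"] assms(3) op_exp_of_vanishing by metis

lemma funpow_shift_binomial:
  fixes g :: "'a::real_vector \<Rightarrow> 'a"
  assumes g: "linear g"
  shows "((\<lambda>y. g y - c *\<^sub>R y) ^^ n) x = (\<Sum>k\<le>n. (real (n choose k) * (-c) ^ (n - k)) *\<^sub>R (g ^^ k) x)"
proof (induction n)
  case 0
  then show ?case by simp
next
  case (Suc n)
  define a where "a n k = real (n choose k) * (-c) ^ (n - k)" for n k
  define S where "S = (\<Sum>k\<le>n. a n k *\<^sub>R (g ^^ k) x)"
  have pascal: "(if k = 0 then 0 else a n (k - 1)) - (if k = Suc n then 0 else c * a n k) = a (Suc n) k"
    if "k \<le> Suc n" for k
  proof (cases k)
    case (Suc m)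
    moreover have "Suc n - k = Suc (n - k)" if "k \<noteq> Suc n"
      using that \<open>k \<le> Suc n\<close> by simp
    ultimately show ?thesis
      by (auto simp: a_def algebra_simps)
  qed (simp add: a_def)
  have "g S = (\<Sum>k\<le>Suc n. (if k = 0 then 0 else a n (k - 1)) *\<^sub>R (g ^^ k) x)"
    unfolding S_def
    by (simp add: linear_sum[OF g] linear_scale[OF g] sum.atMost_Suc_shift[where n=n] del: sum.atMost_Suc)
  moreover have "c *\<^sub>R S = (\<Sum>k\<le>Suc n. (if k = Suc n then 0 else c * a n k) *\<^sub>R (g ^^ k) x)"
    unfolding S_def by (simp add: scaleR_right.sum)
  ultimately have "g S - c *\<^sub>R S = (\<Sum>k\<le>Suc n.
      ((if k = 0 then 0 else a n (k - 1)) - (if k = Suc n then 0 else c * a n k)) *\<^sub>R (g ^^ k) x)"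
    by (simp only: sum_subtractf[symmetric] scaleR_left_diff_distrib)
  also have "\<dots> = (\<Sum>k\<le>Suc n. a (Suc n) k *\<^sub>R (g ^^ k) x)"
    using pascal by (intro sum.cong) auto
  finally show ?case
    using Suc.IH by (simp add: S_def a_def)
qed

lemma op_exp_shift:
  fixes g :: "'a::{real_inner,banach} \<Rightarrow> 'a"
  assumes g: "bounded_linear g"
  shows "op_exp t (\<lambda>y. g y - c *\<^sub>R y) x = exp (- (c * t)) *\<^sub>R op_exp t g x"
proof -
  let ?f = "\<lambda>y. g y - c *\<^sub>R y"
  have f: "bounded_linear ?f"
    using g by (intro bounded_linear_sub bounded_linear_scaleR_right bounded_linear_ident)
  have "op_exp t ?f x \<bullet> z = (exp (- (c * t)) *\<^sub>R op_exp t g x) \<bullet> z" for z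
  proof -
    \<comment> \<open>Against a fixed \<open>z\<close> the left side is the Cauchy product of the series \<open>u\<close> and \<open>w\<close>.\<close>
    define u where "u k = (t ^ k / fact k) * ((g ^^ k) x \<bullet> z)" for k
    define w where "w m = (- (c * t)) ^ m / fact m" for m
    have terms: "((t ^ n / fact n) *\<^sub>R (?f ^^ n) x) \<bullet> z = (\<Sum>k\<le>n. u k * w (n - k))" for n
    proof -
      have coeff: "(t ^ n / fact n) * (real (n choose k) * (-c) ^ (n - k)) = (t ^ k / fact k) * w (n - k)"
        if "k \<le> n" for k
      proof -
        have "t ^ n = t ^ k * t ^ (n - k)"
          using that by (simp flip: power_add)
        then show ?thesis
          unfolding w_def binomial_fact[OF that]
          by (simp add: field_simps power_mult_distrib[symmetric])
      qed
      have "((t ^ n / fact n) *\<^sub>R (?f ^^ n) x) \<bullet> z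
          = (\<Sum>k\<le>n. ((t ^ n / fact n) * (real (n choose k) * (-c) ^ (n - k))) * ((g ^^ k) x \<bullet> z))"
        unfolding funpow_shift_binomial[OF bounded_linear.linear[OF g]]
        by (simp add: inner_sum_left sum_distrib_left mult.assoc)
      also have "\<dots> = (\<Sum>k\<le>n. u k * w (n - k))"
      proof (intro sum.cong refl)
        fix k assume "k \<in> {..n}"
        then have "k \<le> n" by simp
        then show "(t ^ n / fact n) * (real (n choose k) * (-c) ^ (n - k)) * ((g ^^ k) x \<bullet> z) = u k * w (n - k)"
          unfolding u_def coeff[OF \<open>k \<le> n\<close>] by simp
      qed
      finally show ?thesis .
    qed
    have "norm (u k) \<le> norm ((t ^ k / fact k) *\<^sub>R (g ^^ k) x) * norm z" for k
      unfolding u_def using Cauchy_Schwarz_ineq2[of "(t ^ k / fact k) *\<^sub>R (g ^^ k) x" z] by simp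
    then have u: "summable (\<lambda>k. norm (u k))"
      by (intro summable_comparison_test'[OF summable_mult2[OF summable_norm_op_exp_terms[OF g]]]) auto
    have w: "summable (\<lambda>m. norm (w m))"
      using summable_norm_exp[of "- (c * t)"] by (simp add: w_def divide_inverse mult.commute)
    have "op_exp t ?f x \<bullet> z = (\<Sum>n. ((t ^ n / fact n) *\<^sub>R (?f ^^ n) x) \<bullet> z)"
      unfolding op_exp_def
      using bounded_linear.suminf[OF bounded_linear_inner_left summable_op_exp_terms[OF f]] by simp
    also have "\<dots> = (\<Sum>k. u k) * (\<Sum>m. w m)"
      unfolding terms by (rule Cauchy_product[OF u w, symmetric])
    also have "(\<Sum>k. u k) = op_exp t g x \<bullet> z"
      unfolding op_exp_def u_def
      using bounded_linear.suminf[OF bounded_linear_inner_left summable_op_exp_terms[OF g]] by simp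
    also have "(\<Sum>m. w m) = exp (- (c * t))"
      using sums_unique[OF exp_converges[of "- (c * t)"]] by (simp add: w_def divide_inverse mult.commute)
    finally show ?thesis
      by (simp add: mult.commute)
  qed
  then show ?thesis
    using vector_eq_rdot by blast
qed

lemma op_exp_nonneg_cart:
  fixes g :: "real^'n \<Rightarrow> real^'n"
  assumes g: "bounded_linear g" and pos: "\<And>y i. (\<And>j. 0 \<le> y $ j) \<Longrightarrow> 0 \<le> g y $ i"
    and p: "\<And>j. 0 \<le> p $ j" and "t \<ge> 0"
  shows "0 \<le> op_exp t g p $ i"
proof -
  have "0 \<le> (g ^^ n) p $ j" for n j
    by (induction n arbitrary: j) (simp_all add: p pos)
  then have "0 \<le> (\<Sum>n. ((t ^ n / fact n) *\<^sub>R (g ^^ n) p) $ i)"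
    using summable_op_exp_terms[OF g] \<open>t \<ge> 0\<close>
    by (intro suminf_nonneg bounded_linear.summable[OF bounded_linear_vec_nth]) auto
  also have "\<dots> = op_exp t g p $ i"
    unfolding op_exp_def
    by (rule bounded_linear.suminf[OF bounded_linear_vec_nth summable_op_exp_terms[OF g], symmetric])
  finally show ?thesis .
qed

definition rate_matrix :: "real^'n^'n \<Rightarrow> bool" where
  "rate_matrix Q \<longleftrightarrow> (\<forall>j k. j \<noteq> k \<longrightarrow> 0 \<le> Q $ j $ k) \<and> (\<forall>k. (\<Sum>j\<in>UNIV. Q $ j $ k) = 0)"

definition prob_vector :: "real^'n \<Rightarrow> bool" where
  "prob_vector p \<longleftrightarrow> (\<forall>j. 0 \<le> p $ j) \<and> (\<Sum>j\<in>UNIV. p $ j) = 1"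

lemma mat_mult_vector_eq_scaleR: "mat c *v x = c *\<^sub>R (x :: real^'n)"
  by (simp add: vec_eq_iff matrix_vector_mult_def mat_def if_distrib [of "\<lambda>a. a * y" for y] cong: if_cong)

lemma op_exp_rate_matrix_prob_vector:
  assumes Q: "rate_matrix Q" and p: "prob_vector p" and "t \<ge> 0"
  shows "prob_vector (op_exp t ((*v) Q) p)"
proof -
  have sum_Qv: "(\<Sum>j\<in>UNIV. (Q *v y) $ j) = 0" for y
  proof -
    have "(\<Sum>j\<in>UNIV. (Q *v y) $ j) = (\<Sum>k\<in>UNIV. (\<Sum>j\<in>UNIV. Q $ j $ k) * y $ k)"
      by (simp add: matrix_vector_mult_def sum_distrib_right) (rule sum.swap)
    then show ?thesis
      using Q by (simp add: rate_matrix_def)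
  qed
  have "(\<Sum>j\<in>UNIV. op_exp t ((*v) Q) p $ j) = (\<Sum>j\<in>UNIV. p $ j)"
    using sum_Qv
    by (intro op_exp_conserved[of _ "\<lambda>y. \<Sum>j\<in>UNIV. y $ j"] bounded_linear_sum bounded_linear_vec_nth)
      simp_all
  moreover have "0 \<le> op_exp t ((*v) Q) p $ i" for i
  proof -
    define c where "c = (\<Sum>k\<in>UNIV. \<bar>Q $ k $ k\<bar>)"
    have diag: "\<bar>Q $ k $ k\<bar> \<le> c" for k
      unfolding c_def by (rule member_le_sum) auto
    have M: "0 \<le> (Q + mat c) $ j $ k" for j k
    proof (cases "j = k")
      case True
      then show ?thesis using diag[of k] by (simp add: mat_def)
    next
      case False
      then show ?thesis using Q by (simp add: rate_matrix_def mat_def)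
    qed
    have Q_shift: "(*v) Q = (\<lambda>y. (Q + mat c) *v y - c *\<^sub>R y)"
      by (simp add: fun_eq_iff matrix_vector_mult_add_rdistrib mat_mult_vector_eq_scaleR)
    have "0 \<le> op_exp t ((*v) (Q + mat c)) p $ i"
      using M p \<open>t \<ge> 0\<close>
      by (intro op_exp_nonneg_cart) (auto simp: prob_vector_def matrix_vector_mult_def intro!: sum_nonneg)
    then show ?thesis
      unfolding Q_shift op_exp_shift[OF matrix_vector_mul_bounded_linear] by simp
  qed
  ultimately show ?thesis
    using p by (simp add: prob_vector_def)
qed

definition basis_mat :: "('n \<Rightarrow> complex^'n) \<Rightarrow> complex^'n^'n" where
  "basis_mat e = (\<chi> i j. e j $ i)"

definition melem :: "('n \<Rightarrow> complex^'n) \<Rightarrow> complex^'n^'n \<Rightarrow> 'n \<Rightarrow> 'n \<Rightarrow> complex" where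
  "melem e X j k = braket (e j) (X *v e k)"

lemma cadj_cadj [simp]: "cadj (cadj X) = X"
  by (simp add: cadj_def vec_eq_iff)

lemma cadj_mult: "cadj (X ** Y) = cadj Y ** cadj X"
  by (simp add: cadj_def vec_eq_iff matrix_matrix_mult_def mult.commute)

lemma cadj_basis_mat_mult:
  assumes "orthonormal_basis e"
  shows "cadj (basis_mat e) ** basis_mat e = mat 1"
  using assms
  by (simp add: vec_eq_iff matrix_matrix_mult_def cadj_def basis_mat_def mat_def orthonormal_basis_def braket_def)

lemma basis_mat_mult_cadj:
  assumes "orthonormal_basis e"
  shows "basis_mat e ** cadj (basis_mat e) = mat 1"
  using cadj_basis_mat_mult[OF assms] matrix_left_right_inverse by blast

lemma melem_conv_basis_mat: "melem e X j k = (cadj (basis_mat e) ** X ** basis_mat e) $ j $ k"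
  by (simp add: melem_def braket_def matrix_matrix_mult_def matrix_vector_mult_def cadj_def basis_mat_def
      sum_distrib_left sum_distrib_right mult.assoc) (rule sum.swap)

lemma melem_mult:
  assumes "orthonormal_basis e"
  shows "melem e (X ** Y) j k = (\<Sum>l\<in>UNIV. melem e X j l * melem e Y l k)"
proof -
  let ?U = "basis_mat e"
  have "cadj ?U ** (X ** Y) ** ?U = cadj ?U ** (X ** (?U ** cadj ?U) ** Y) ** ?U"
    using basis_mat_mult_cadj[OF assms] by simp
  also have "\<dots> = (cadj ?U ** X ** ?U) ** (cadj ?U ** Y ** ?U)"
    by (simp add: matrix_mul_assoc)
  finally show ?thesis
    unfolding melem_conv_basis_mat by (simp add: matrix_matrix_mult_def)
qed

lemma melem_cadj: "melem e (cadj X) j k = cnj (melem e X k j)"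
proof -
  have "cadj (basis_mat e) ** cadj X ** basis_mat e = cadj (cadj (basis_mat e) ** X ** basis_mat e)"
    by (simp add: cadj_mult matrix_mul_assoc)
  then show ?thesis
    unfolding melem_conv_basis_mat by (simp add: cadj_def)
qed

lemma melem_eqI:
  assumes "orthonormal_basis e" and "\<And>j k. melem e X j k = melem e Y j k"
  shows "X = Y"
proof -
  let ?U = "basis_mat e"
  have conj: "X = ?U ** (cadj ?U ** X ** ?U) ** cadj ?U" for X
    by (simp add: matrix_mul_assoc basis_mat_mult_cadj[OF assms(1)])
       (simp add: matrix_mul_assoc[symmetric] basis_mat_mult_cadj[OF assms(1)])
  have "cadj ?U ** X ** ?U = cadj ?U ** Y ** ?U"
    using assms(2) unfolding melem_conv_basis_mat by (simp add: vec_eq_iff)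
  then show ?thesis
    using conj by metis
qed

lemma mult_vector_scaleR: "(r *\<^sub>R X) *v v = r *\<^sub>R (X *v v :: complex^'n)"
  by (simp add: vec_eq_iff matrix_vector_mult_def scaleR_right.sum mult_scaleR_left)

lemma linear_melem: "linear (\<lambda>X. melem e X j k)"
proof (rule linearI)
  show "melem e (X + Y) j k = melem e X j k + melem e Y j k" for X Y
    by (simp add: melem_def braket_def matrix_vector_mult_add_rdistrib distrib_left sum.distrib)
  show "melem e (r *\<^sub>R X) j k = r *\<^sub>R melem e X j k" for r X
    by (simp add: melem_def braket_def mult_vector_scaleR scaleR_right.sum)
qed

lemma melem_sum: "melem e (\<Sum>a\<in>A. F a) j k = (\<Sum>a\<in>A. melem e (F a) j k)"
  by (rule linear_sum[OF linear_melem])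

lemma melem_add: "melem e (X + Y) j k = melem e X j k + melem e Y j k"
  by (rule linear_add[OF linear_melem])

lemma melem_diff: "melem e (X - Y) j k = melem e X j k - melem e Y j k"
  by (rule linear_diff[OF linear_melem])

lemma melem_scaleR: "melem e (r *\<^sub>R X) j k = of_real r * melem e X j k"
  using linear_scale[OF linear_melem] by (simp add: scaleR_conv_of_real)

lemma braket_smult: "braket v (c *s w) = c * braket v w"
  by (simp add: braket_def sum_distrib_left mult.left_commute)

lemma ketbra_mult_vector: "ketbra a b *v v = braket b v *s a"
  by (simp add: ketbra_def braket_def vec_eq_iff matrix_vector_mult_def sum_distrib_left mult_ac)

lemma melem_ketbra:
  assumes "orthonormal_basis e"
  shows "melem e (ketbra (e a) (e b)) j k = (if j = a \<and> k = b then 1 else 0)"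
  using assms by (simp add: melem_def ketbra_mult_vector braket_smult orthonormal_basis_def)

lemma melem_eigenbasis:
  assumes "orthonormal_basis e" and "\<And>j. H *v e j = complex_of_real (E j) *s e j"
  shows "melem e H j k = (if j = k then complex_of_real (E j) else 0)"
  using assms by (simp add: melem_def braket_smult orthonormal_basis_def)

lemma melem_eigenbasis_mult:
  assumes e: "orthonormal_basis e" and H: "\<And>j. H *v e j = complex_of_real (E j) *s e j"
  shows "melem e (H ** X) j k = complex_of_real (E j) * melem e X j k"
    and "melem e (X ** H) j k = melem e X j k * complex_of_real (E k)"
  by (simp_all add: melem_mult[OF e] melem_eigenbasis[OF e H] cong: if_cong
      add: if_distrib [of "\<lambda>a. a * y" for y] if_distrib [of "\<lambda>a. y * a" for y])

definition diag_mat :: "('n \<Rightarrow> complex^'n) \<Rightarrow> real^'n \<Rightarrow> complex^'n^'n" where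
  "diag_mat e s = (\<Sum>j\<in>UNIV. s $ j *\<^sub>R ketbra (e j) (e j))"

lemma linear_diag_mat: "linear (diag_mat e)"
  by (rule linearI) (simp_all add: diag_mat_def scaleR_add_left sum.distrib scaleR_right.sum)

lemma melem_diag_mat:
  assumes "orthonormal_basis e"
  shows "melem e (diag_mat e s) j k = (if j = k then of_real (s $ j) else 0)"
  by (cases "j = k")
    (auto simp: diag_mat_def melem_sum melem_scaleR melem_ketbra[OF assms] if_distrib
      intro!: sum.neutral cong: if_cong)

lemma csmat_of_real: "csmat (of_real r) X = r *\<^sub>R X"
  by (simp add: csmat_def vec_eq_iff scaleR_conv_of_real[where 'a=complex])

lemma G0_eq_diag_mat:
  assumes "\<And>j. melem e X j j = of_real (s $ j)"
  shows "G0 e X = diag_mat e s"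
  using assms by (simp add: G0_def diag_mat_def csmat_of_real flip: melem_def)

lemma G0_diag_mat:
  assumes "orthonormal_basis e"
  shows "G0 e (diag_mat e s) = diag_mat e s"
  by (rule G0_eq_diag_mat) (simp add: melem_diag_mat[OF assms])

lemma hermitian_diag_mat: "hermitian (diag_mat e s)"
  by (simp add: hermitian_def diag_mat_def cadj_def vec_eq_iff ketbra_def cnj_sum mult.commute)

lemma trace_diag_mat:
  assumes "orthonormal_basis e"
  shows "trace (diag_mat e s) = of_real (\<Sum>j\<in>UNIV. s $ j)"
proof -
  have "trace (diag_mat e s) = (\<Sum>j\<in>UNIV. of_real (s $ j) * braket (e j) (e j))"
    unfolding trace_def diag_mat_def
    by (simp add: ketbra_def braket_def scaleR_conv_of_real[where 'a=complex] sum_distrib_left mult_ac)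
      (rule sum.swap)
  then show ?thesis
    using assms by (simp add: orthonormal_basis_def)
qed

lemma braket_sum: "braket v (\<Sum>j\<in>S. w j) = (\<Sum>j\<in>S. braket v (w j))"
  by (simp add: braket_def sum_distrib_left) (rule sum.swap)

lemma braket_scaleR: "braket v (r *\<^sub>R w) = of_real r * braket v w"
  by (simp add: braket_def sum_distrib_left scaleR_conv_of_real[where 'a=complex] mult_ac)

lemma mult_vector_sum: "(\<Sum>j\<in>S. M j) *v (v :: complex^'n) = (\<Sum>j\<in>S. M j *v v)"
  by (induction S rule: infinite_finite_induct) (simp_all add: matrix_vector_mult_add_rdistrib)

lemma braket_diag_mat:
  "braket v (diag_mat e s *v v) = of_real (\<Sum>j\<in>UNIV. s $ j * (cmod (braket (e j) v))\<^sup>2)"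
proof -
  have "braket v (e j) * braket (e j) v = of_real ((cmod (braket (e j) v))\<^sup>2)" for j
    using complex_norm_square[of "braket (e j) v"]
    by (simp add: braket_def cnj_sum mult.commute)
  then show ?thesis
    by (simp add: diag_mat_def mult_vector_sum mult_vector_scaleR braket_sum braket_scaleR
        ketbra_mult_vector braket_smult mult_ac)
qed

lemma density_matrix_diag_mat_iff:
  assumes "orthonormal_basis e"
  shows "density_matrix (diag_mat e s) \<longleftrightarrow> prob_vector s"
proof
  assume rho: "density_matrix (diag_mat e s)"
  then have "0 \<le> Re (melem e (diag_mat e s) j j)" for j
    by (simp add: density_matrix_def psd_def melem_def)
  moreover have "(\<Sum>j\<in>UNIV. s $ j) = 1"
    using rho trace_diag_mat[OF assms, of s] by (metis density_matrix_def of_real_eq_1_iff)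
  ultimately show "prob_vector s"
    by (simp add: prob_vector_def melem_diag_mat[OF assms])
next
  assume "prob_vector s"
  then show "density_matrix (diag_mat e s)"
    by (auto simp: density_matrix_def psd_def prob_vector_def hermitian_diag_mat braket_diag_mat
        trace_diag_mat[OF assms] intro!: sum_nonneg)
qed

lemma diag_mat_commute:
  assumes e: "orthonormal_basis e" and H: "\<And>j. H *v e j = complex_of_real (E j) *s e j"
  shows "H ** diag_mat e s = diag_mat e s ** H"
  by (rule melem_eqI[OF e]) (simp add: melem_eigenbasis_mult[OF e H] melem_diag_mat[OF e])

lemma commuting_eq_diag_mat:
  assumes e: "orthonormal_basis e" and H: "\<And>j. H *v e j = complex_of_real (E j) *s e j"
    and "inj E" and "hermitian X" and "H ** X = X ** H"
  shows "X = diag_mat e (\<chi> j. Re (melem e X j j))"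
proof (rule melem_eqI[OF e])
  fix j k
  show "melem e X j k = melem e (diag_mat e (\<chi> j. Re (melem e X j j))) j k"
  proof (cases "j = k")
    case True
    have "cnj (melem e X j j) = melem e X j j"
      using melem_cadj[of e X j j] \<open>hermitian X\<close> by (simp add: hermitian_def)
    then show ?thesis
      using True by (simp add: melem_diag_mat[OF e] complex_eq_iff)
  next
    case False
    then have "E j \<noteq> E k"
      using \<open>inj E\<close> by (meson injD)
    moreover have "of_real (E j) * melem e X j k = melem e X j k * of_real (E k)"
      using \<open>H ** X = X ** H\<close> by (metis melem_eigenbasis_mult[OF e H])
    ultimately show ?thesis
      using False by (simp add: melem_diag_mat[OF e] mult.commute)
  qed
qed

text \<open>For \<open>j \<noteq> k\<close>, \<open>pauli_rates e A h $ j $ k\<close> is the rate of the jump \<open>k \<rightarrow> j\<close> between eigenstates.\<close>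

definition pauli_rates :: "('n \<Rightarrow> complex^'n) \<Rightarrow> 'a set \<Rightarrow> ('a \<Rightarrow> complex^'n^'n) \<Rightarrow> real^'n^'n" where
  "pauli_rates e A h = (\<chi> j k. \<Sum>a\<in>A. (cmod (melem e (h a) j k))\<^sup>2
      - (if j = k then (\<Sum>i\<in>UNIV. (cmod (melem e (h a) i k))\<^sup>2) else 0))"

lemma rate_matrix_pauli_rates: "rate_matrix (pauli_rates e A h)"
proof -
  have "(\<Sum>j\<in>UNIV. pauli_rates e A h $ j $ k) = 0" for k
  proof -
    have "(\<Sum>j\<in>UNIV. pauli_rates e A h $ j $ k) = (\<Sum>a\<in>A. \<Sum>j\<in>UNIV. (cmod (melem e (h a) j k))\<^sup>2
        - (if j = k then (\<Sum>i\<in>UNIV. (cmod (melem e (h a) i k))\<^sup>2) else 0))"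
      by (simp add: pauli_rates_def) (rule sum.swap)
    then show ?thesis
      by (simp add: sum_subtractf)
  qed
  then show ?thesis
    by (simp add: rate_matrix_def pauli_rates_def sum_nonneg)
qed

lemma melem_sandwich_diag_mat:
  assumes e: "orthonormal_basis e"
  shows "melem e (X ** diag_mat e s ** cadj X) j j = of_real (\<Sum>l\<in>UNIV. (cmod (melem e X j l))\<^sup>2 * s $ l)"
proof -
  have "melem e (X ** diag_mat e s ** cadj X) j j = (\<Sum>l\<in>UNIV. of_real (s $ l) * (melem e X j l * cnj (melem e X j l)))"
    by (simp add: melem_mult[OF e] melem_cadj melem_diag_mat[OF e] mult_ac
        if_distrib [of "\<lambda>a. y * a" for y] cong: if_cong)
  then show ?thesis
    by (simp add: mult.commute flip: complex_norm_square)
qed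

lemma melem_mult_diag_mat:
  assumes e: "orthonormal_basis e"
  shows "melem e (Y ** diag_mat e s) j j = melem e Y j j * of_real (s $ j)"
    and "melem e (diag_mat e s ** Y) j j = of_real (s $ j) * melem e Y j j"
  by (simp_all add: melem_mult[OF e] melem_diag_mat[OF e] cong: if_cong
      add: if_distrib [of "\<lambda>a. a * y" for y] if_distrib [of "\<lambda>a. y * a" for y])

lemma melem_cadj_mult_self:
  assumes e: "orthonormal_basis e"
  shows "melem e (cadj X ** X) j j = of_real (\<Sum>i\<in>UNIV. (cmod (melem e X i j))\<^sup>2)"
  by (simp add: melem_mult[OF e] melem_cadj mult.commute flip: complex_norm_square)

lemma melem_dissipator_diag_mat:
  assumes e: "orthonormal_basis e"
  shows "melem e (dissipator A h (diag_mat e s)) j j = of_real ((pauli_rates e A h *v s) $ j)"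
proof -
  define N where "N a = (\<Sum>i\<in>UNIV. (cmod (melem e (h a) i j))\<^sup>2)" for a
  have "(pauli_rates e A h *v s) $ j
      = (\<Sum>a\<in>A. \<Sum>k\<in>UNIV. (cmod (melem e (h a) j k))\<^sup>2 * s $ k - (if j = k then N a * s $ k else 0))"
    by (simp add: pauli_rates_def N_def matrix_vector_mult_def sum_distrib_right left_diff_distrib
        if_distrib [of "\<lambda>a. a * y" for y] cong: if_cong) (rule sum.swap)
  also have "\<dots> = (\<Sum>a\<in>A. (\<Sum>k\<in>UNIV. (cmod (melem e (h a) j k))\<^sup>2 * s $ k) - N a * s $ j)"
    by (simp add: sum_subtractf)
  finally show ?thesis
    unfolding dissipator_def
    by (simp add: melem_sum melem_diff melem_scaleR melem_add melem_sandwich_diag_mat[OF e]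
        melem_mult_diag_mat[OF e] melem_cadj_mult_self[OF e] flip: N_def)
qed

lemma G0_dissipator_G0_diag_mat:
  assumes e: "orthonormal_basis e"
  shows "G0 e (dissipator A h (G0 e (diag_mat e s))) = diag_mat e (pauli_rates e A h *v s)"
  by (simp add: G0_diag_mat[OF e] G0_eq_diag_mat melem_dissipator_diag_mat[OF e])

theorem lemma4:
  fixes H :: "complex^'n^'n"
    and e :: "'n \<Rightarrow> complex^'n"
    and E :: "'n \<Rightarrow> real"
    and A :: "'a set"
    and h :: "'a \<Rightarrow> complex^'n^'n"
    and \<rho> :: "complex^'n^'n"
    and t :: real
  assumes "hermitian H"
    and "orthonormal_basis e"
    and "\<And>j. H *v e j = complex_of_real (E j) *s e j"
    and "inj E"
    and "finite A"
    and "density_matrix \<rho>"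
    and "H ** \<rho> = \<rho> ** H"
    and "t \<ge> 0"
  shows "density_matrix (super_exp t (G0 e \<circ> dissipator A h \<circ> G0 e) \<rho>)
       \<and> H ** super_exp t (G0 e \<circ> dissipator A h \<circ> G0 e) \<rho>
         = super_exp t (G0 e \<circ> dissipator A h \<circ> G0 e) \<rho> ** H"
proof -
  note e = assms(2) and H = assms(3)
  let ?L = "G0 e \<circ> dissipator A h \<circ> G0 e"
  define p where "p = (\<chi> j. Re (melem e \<rho> j j))"
  have \<rho>: "\<rho> = diag_mat e p"
    unfolding p_def using assms(6,7)
    by (intro commuting_eq_diag_mat[OF e H assms(4)]) (simp_all add: density_matrix_def psd_def)
  then have p: "prob_vector p"
    using assms(6) density_matrix_diag_mat_iff[OF e] by simp
  have "super_exp t ?L \<rho> = diag_mat e (op_exp t ((*v) (pauli_rates e A h)) p)"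
    unfolding super_exp_def op_exp_def[symmetric] \<rho>
    using linear_diag_mat linear_conv_bounded_linear
    by (intro op_exp_intertwine[symmetric]) (auto simp: G0_dissipator_G0_diag_mat[OF e])
  moreover have "prob_vector (op_exp t ((*v) (pauli_rates e A h)) p)"
    by (rule op_exp_rate_matrix_prob_vector[OF rate_matrix_pauli_rates p assms(8)])
  ultimately show ?thesis
    using density_matrix_diag_mat_iff[OF e] diag_mat_commute[OF e H] by simp
qed

end
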